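(* Let $\mathbf v$ be a complementary symmetric Rote sequence and let $\mathbf u$ be the standard Sturmian sequence such that $\mathcal L(\mathcal S(\mathbf v))=\mathcal L(\mathbf u)$. Then $\mathrm{cr}(\mathbf v)=\sup(M_1\cup M_2\cup M_3)$, where (a) if the directive sequence of $\mathbf u$ is $G^{a_1}D^{a_2}G^{a_3}D^{a_4}\cdots$: $$M_1=\Bigl\{a_{N+1}+2+\frac{q'_{N-1}-1}{q'_N} : q_N\text{ is even},\ N\in\mathbb N\Bigr\},$$ $$M_2=\Bigl\{\frac{a_{N+1}+2}{2}+\frac{q'_{N-1}-1}{2q'_N} : q_N\text{ is odd},\ N\in\mathbb N\Bigr\},$$ $$M_3=\Bigl\{2+\frac{q'_N-1}{q'_{N-1}+q'_N} : q_{N-1},q_N\text{ are odd and }a_{N+1}>1,\ N\ge1\Bigr\};$$ (b) if the directive sequence of $\mathbf u$ is $D^{a_1}G^{a_2}D^{a_3}G^{a_4}\cdots$: $$M_1=\Bigl\{a_{N+1}+2+\frac{q'_{N-1}-1}{q'_N} : p_N\text{ is even},\ N\in\mathbb N\Bigr\},$$ $$M_2=\Bigl\{\frac{a_{N+1}+2}{2}+\frac{q'_{N-1}-1}{2q'_N} : p_N\text{ is odd},\ N\in\mathbb N\Bigr\},$$ $$M_3=\Bigl\{2+\frac{q'_N-1}{q'_{N-1}+q'_N} : p_{N-1},p_N\text{ are odd and }a_{N+1}>1,\ N\ge1\Bigr\}.$$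
   Context: $\mathbb N=\{0,1,2,\dots\}$. Sequences are right-infinite words; $\mathcal L(\mathbf u)$ is the set of finite factors of $\mathbf u$. A word $z$ equals $u^e$ (with $u$ non-empty, $e=|z|/|u|$) if $z$ is a prefix of $u^\omega=uuu\cdots$. For a non-empty factor $u$ of $\mathbf u$, $\mathrm{ind}_{\mathbf u}(u)=\sup\{e\in\mathbb Q:u^e\in\mathcal L(\mathbf u)\}$, and $\mathrm{cr}(\mathbf u)=\sup\{\mathrm{ind}_{\mathbf u}(u):u\text{ a non-empty factor of }\mathbf u\}$ (possibly $+\infty$). A Rote sequence is a binary sequence having exactly $2n$ factors of length $n$ for every $n\ge1$. It is complementary symmetric (CS) if its language is closed under the exchange of letters $0\leftrightarrow1$. For a binary sequence $\mathbf v=v_0v_1\cdots$, $\mathcal S(\mathbf v)=u_0u_1\cdots$ with $u_i=v_i+v_{i+1}\bmod2$. A Sturmian sequence (over $\{0,1\}$) has exactly $n+1$ factors of length $n$ for every $n\in\mathbb N$; it is standard if both $0\mathbf u$ and $1\mathbf u$ are Sturmian. Known facts: $\mathbf v$ is CS Rote iff $\mathcal S(\mathbf v)$ is Sturmian; each Sturmian sequence has the same language as exactly one standard Sturmian sequence. Directive sequence: let $G:0\mapsto10,\ 1\mapsto1$ and $D:0\mapsto0,\ 1\mapsto01$. For every standard Sturmian $\mathbf u$ there is a unique sequence $\Delta_0\Delta_1\Delta_2\cdots\in\{G,D\}^{\mathbb N}$ (the directive sequence of $\mathbf u$) for which there are standard Sturmian sequences $\mathbf u^{(n)}$ with $\mathbf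 u=\Delta_0\Delta_1\cdots\Delta_{n-1}(\mathbf u^{(n)})$ for all $n\in\mathbb N$. It contains infinitely many $G$ and infinitely many $D$, so it is $G^{a_1}D^{a_2}G^{a_3}D^{a_4}\cdots$ or $D^{a_1}G^{a_2}D^{a_3}G^{a_4}\cdots$ with positive integers $a_i$. The integers $p_N,q_N,q'_N$ (related to the convergents of $\theta=[0,a_1,a_2,\dots]$ and $\theta/(1+\theta)$) all satisfy $X_N=a_NX_{N-1}+X_{N-2}$ for $N\ge1$, with $p_{-1}=1,p_0=0$; $q_{-1}=0,q_0=1$; $q'_{-1}=q'_0=1$. Thus $q'_N=p_N+q_N$. *)

theory Defs
  imports Complex_Main "HOL-Library.Z2" "HOL-Library.Extended_Real"
begin

text \<open>
  Letters are elements of the two-element field \<^typ>\<open>bit\<close>, so that \<open>+\<close> on letters is addition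
  modulo 2.  A sequence is a function on \<^typ>\<open>nat\<close>.
\<close>

definition lang :: "(nat \<Rightarrow> 'a) \<Rightarrow> 'a list set" where
  "lang u = {map u [i..<i + n] | i n. True}"

definition factors :: "(nat \<Rightarrow> 'a) \<Rightarrow> nat \<Rightarrow> 'a list set" where
  "factors u n = {w \<in> lang u. length w = n}"


subsection \<open>Powers, index and critical exponent\<close>

definition omega_power :: "'a list \<Rightarrow> nat \<Rightarrow> 'a" where
  "omega_power u = (\<lambda>i. u ! (i mod length u))"

definition is_power :: "'a list \<Rightarrow> 'a list \<Rightarrow> rat \<Rightarrow> bool" where
  "is_power z u e \<longleftrightarrow>
     u \<noteq> [] \<and> e = of_nat (length z) / of_nat (length u) \<and>
     z = map (omega_power u) [0..<length z]"

definition ind :: "(nat \<Rightarrow> 'a) \<Rightarrow> 'a list \<Rightarrow> ereal" where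
  "ind v u = Sup {ereal (real_of_rat e) | e. \<exists>z \<in> lang v. is_power z u e}"

definition cr :: "(nat \<Rightarrow> 'a) \<Rightarrow> ereal" where
  "cr v = Sup {ind v u | u. u \<noteq> [] \<and> u \<in> lang v}"


subsection \<open>Rote and Sturmian sequences\<close>

definition rote :: "(nat \<Rightarrow> bit) \<Rightarrow> bool" where
  "rote v \<longleftrightarrow> (\<forall>n\<ge>1. card (factors v n) = 2 * n)"

text \<open>On \<^typ>\<open>bit\<close>, the map \<open>x \<mapsto> x + 1\<close> exchanges the two letters.\<close>

definition cs_rote :: "(nat \<Rightarrow> bit) \<Rightarrow> bool" where
  "cs_rote v \<longleftrightarrow> rote v \<and> (\<forall>w \<in> lang v. map (\<lambda>x. x + 1) w \<in> lang v)"

definition \<S> :: "(nat \<Rightarrow> bit) \<Rightarrow> nat \<Rightarrow> bit" where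
  "\<S> v = (\<lambda>i. v i + v (i + 1))"

definition sturmian :: "(nat \<Rightarrow> bit) \<Rightarrow> bool" where
  "sturmian u \<longleftrightarrow> (\<forall>n. card (factors u n) = n + 1)"

text \<open>\<^term>\<open>case_nat x u\<close> is the sequence \<open>u\<close> with the letter \<open>x\<close> prepended.\<close>

definition standard_sturmian :: "(nat \<Rightarrow> bit) \<Rightarrow> bool" where
  "standard_sturmian u \<longleftrightarrow>
     sturmian u \<and> sturmian (case_nat 0 u) \<and> sturmian (case_nat 1 u)"


subsection \<open>Morphisms and directive sequences\<close>

definition morph_G :: "bit \<Rightarrow> bit list" where
  "morph_G x = (if x = 0 then [1, 0] else [1])"

definition morph_D :: "bit \<Rightarrow> bit list" where
  "morph_D x = (if x = 0 then [0] else [0, 1])"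

text \<open>
  The image of a sequence under a morphism.  This is meaningful for non-erasing morphisms only:
  then the image of a prefix of length \<open>i + 1\<close> has more than \<open>i\<close> letters.
\<close>

definition apply_morph :: "('a \<Rightarrow> 'b list) \<Rightarrow> (nat \<Rightarrow> 'a) \<Rightarrow> nat \<Rightarrow> 'b" where
  "apply_morph \<phi> u = (\<lambda>i. concat (map \<phi> (map u [0..<i + 1])) ! i)"

lemma length_concat_nonerasing:
  assumes "\<And>x. \<phi> x \<noteq> []"
  shows "length xs \<le> length (concat (map \<phi> xs))"
proof (induction xs)
  case (Cons x xs)
  have "1 \<le> length (\<phi> x)"
    using assms[of x] by (cases "\<phi> x") auto
  with Cons show ?case by simp
qed simp

lemma apply_morph_nth:
  assumes ne: "\<And>x. \<phi> x \<noteq> []" and i: "i < length (concat (map \<phi> (map u [0..<n])))"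
  shows "apply_morph \<phi> u i = concat (map \<phi> (map u [0..<n])) ! i"
proof -
  define P where "P m = concat (map \<phi> (map u [0..<m]))" for m
  have app: "P (m + k) = P m @ concat (map \<phi> (map u [m..<m + k]))" for m k
    unfolding P_def by (simp add: upt_add_eq_append[of 0 m k])
  have ext: "P m' ! i = P m ! i" if "m \<le> m'" "i < length (P m)" for m m'
    using app[of m "m' - m"] that by (simp add: nth_append)
  have "i < length (P (i + 1))"
    using length_concat_nonerasing[of \<phi> "map u [0..<i + 1]", OF ne] unfolding P_def by simp
  then have "P (i + 1) ! i = P n ! i"
    using ext[of "i + 1" n] ext[of n "i + 1"] i unfolding P_def[symmetric]
    by (cases "i + 1 \<le> n") auto
  then show ?thesis
    unfolding apply_morph_def P_def .
qed

text \<open>The \<open>foldr\<close> term is \<open>\<Delta>\<^sub>0 (\<Delta>\<^sub>1 (\<dots> (\<Delta>\<^sub>n\<^sub>-\<^sub>1 (U n))))\<close>.\<close>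

definition directive_seq :: "(nat \<Rightarrow> bit) \<Rightarrow> (nat \<Rightarrow> bit \<Rightarrow> bit list) \<Rightarrow> bool" where
  "directive_seq u \<Delta> \<longleftrightarrow>
     (\<forall>n. \<Delta> n \<in> {morph_G, morph_D}) \<and>
     (\<exists>U. \<forall>n. standard_sturmian (U n) \<and>
              u = foldr (\<lambda>i. apply_morph (\<Delta> i)) [0..<n] (U n))"

text \<open>
  \<^term>\<open>alternating_blocks X Y a \<Delta>\<close> says that \<open>\<Delta>\<close> is \<open>X\<^bsup>a 1\<^esup> Y\<^bsup>a 2\<^esup> X\<^bsup>a 3\<^esup> Y\<^bsup>a 4\<^esup> \<dots>\<close> with positive exponents
  \<open>a 1, a 2, \<dots>\<close>; the value \<open>a 0\<close> is irrelevant.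
\<close>

definition alternating_blocks :: "'b \<Rightarrow> 'b \<Rightarrow> (nat \<Rightarrow> nat) \<Rightarrow> (nat \<Rightarrow> 'b) \<Rightarrow> bool" where
  "alternating_blocks X Y a \<Delta> \<longleftrightarrow>
     (\<forall>i\<ge>1. a i > 0) \<and>
     (\<forall>k n. (\<Sum>i=1..k. a i) \<le> n \<and> n < (\<Sum>i=1..k + 1. a i) \<longrightarrow>
            \<Delta> n = (if even k then X else Y))"


subsection \<open>The integers \<open>p\<^sub>N\<close>, \<open>q\<^sub>N\<close>, \<open>q'\<^sub>N\<close>\<close>

text \<open>
  \<open>conv_rec x y a k\<close> is \<open>X\<^sub>k\<^sub>-\<^sub>1\<close>, where \<open>X\<^sub>N = a\<^sub>N X\<^sub>N\<^sub>-\<^sub>1 + X\<^sub>N\<^sub>-\<^sub>2\<close> for \<open>N \<ge> 1\<close>, with initial values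
  \<open>x\<close> at index \<open>-1\<close> and \<open>y\<close> at index \<open>0\<close>.  The sequences below are indexed by the integers
  from \<open>-1\<close> on.
\<close>

fun conv_rec :: "nat \<Rightarrow> nat \<Rightarrow> (nat \<Rightarrow> nat) \<Rightarrow> nat \<Rightarrow> nat" where
  "conv_rec x y a 0 = x"
| "conv_rec x y a (Suc 0) = y"
| "conv_rec x y a (Suc (Suc k)) = a (Suc k) * conv_rec x y a (Suc k) + conv_rec x y a k"

definition conv_p :: "(nat \<Rightarrow> nat) \<Rightarrow> int \<Rightarrow> nat" where
  "conv_p a N = conv_rec 1 0 a (nat (N + 1))"

definition conv_q :: "(nat \<Rightarrow> nat) \<Rightarrow> int \<Rightarrow> nat" where
  "conv_q a N = conv_rec 0 1 a (nat (N + 1))"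

definition conv_q' :: "(nat \<Rightarrow> nat) \<Rightarrow> int \<Rightarrow> nat" where
  "conv_q' a N = conv_rec 1 1 a (nat (N + 1))"

lemma conv_rec_int:
  assumes "N \<ge> (1::int)"
  shows "conv_rec x y a (nat (N + 1)) =
           a (nat N) * conv_rec x y a (nat (N - 1 + 1)) + conv_rec x y a (nat (N - 2 + 1))"
proof -
  obtain k where "N = int (Suc k)"
    using assms by (metis not_one_le_zero of_nat_0 old.nat.exhaust zero_le_imp_eq_int
        order_trans zero_le_one)
  then have "nat (N + 1) = Suc (Suc k)" "nat N = Suc k" "nat (N - 1 + 1) = Suc k"
    "nat (N - 2 + 1) = k"
    by simp_all
  then show ?thesis by simp
qed

lemma p_q_initial:
  "conv_p a (-1) = 1" "conv_p a 0 = 0" "conv_q a (-1) = 0" "conv_q a 0 = 1" "conv_q' a (-1) = 1" "conv_q' a 0 = 1"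
  by (simp_all add: conv_p_def conv_q_def conv_q'_def)

lemma p_q_recurrence:
  assumes "N \<ge> 1"
  shows "conv_p a N = a (nat N) * conv_p a (N - 1) + conv_p a (N - 2)"
    and "conv_q a N = a (nat N) * conv_q a (N - 1) + conv_q a (N - 2)"
    and "conv_q' a N = a (nat N) * conv_q' a (N - 1) + conv_q' a (N - 2)"
  using conv_rec_int[OF assms] unfolding conv_p_def conv_q_def conv_q'_def by blast+

end

theory Submission
  imports Defs
begin

text \<open>
  A repetition of \<open>\<^bold>v\<close> of period \<open>P\<close> and length \<open>P + m + 1\<close> is the same as a factor of \<open>\<^bold>u\<close> of length
  \<open>P + m\<close> and period \<open>P\<close> whose prefix of length \<open>P\<close> has an even number of ones.  Such a factor is
  described by its period word and by the word of length \<open>m\<close> that is repeated.  Both can be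
  desubstituted through the morphisms of the directive sequence: the period word is replaced by a
  preimage, and so is the repeated word after it has been extended as far as the morphism forces.
  If one letter 0 and one letter 1 are added to the Parikh vector of the extended repeated word, this
  vector also transforms linearly.  The sum of the two lengths strictly decreases, so one
  reaches a level \<open>n\<close> at which the repeated word is empty.  Conversely, any non-empty factor of
  \<open>\<^bold>u\<^sup>(\<^sup>n\<^sup>)\<close> can be taken as a period word with empty repeated word.  Hence, with
  \<open>\<Phi>\<^sub>n = \<Delta>\<^sub>0 \<dots> \<Delta>\<^sub>n\<^sub>-\<^sub>1\<close>, the critical exponent is the supremum of
  \<open>1 + (|\<Phi>\<^sub>n(01)| - 1) / |\<Phi>\<^sub>n(w)|\<close> over all \<open>n\<close> and all non-empty factors \<open>w\<close> of \<open>\<^bold>u\<^sup>(\<^sup>n\<^sup>)\<close> for which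
  \<open>\<Phi>\<^sub>n(w)\<close> has an even number of ones.  Within a block of the directive sequence only
  \<open>w = x\<close>, \<open>w = xx\<close> and \<open>w = y\<close> matter, where \<open>x\<close> is the letter fixed by the morphism of the
  block and \<open>y\<close> the other one: longer powers of \<open>x\<close> give smaller values, \<open>y\<close> is isolated, and a
  factor containing both letters gives at most 2, which is at most the supremum.
\<close>

section \<open>The two morphisms as one family, and the decoding of their images\<close>

definition other :: "bit \<Rightarrow> bit" where
  "other c = c + 1"

lemma other_simps [simp]: "other 0 = 1" "other 1 = 0"
  by (simp_all add: other_def)

lemma other_other [simp]: "other (other c) = c"
  by (cases c) simp_all

lemma other_neq [simp]: "other c \<noteq> c" "c \<noteq> other c"
  by (cases c; simp)+

text \<open>\<open>G\<close> and \<open>D\<close> differ only in the letter that begins every image.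
  Taking this letter as a parameter lets each argument be made once.\<close>

definition mor :: "bit \<Rightarrow> bit \<Rightarrow> bit list" where
  "mor c x = (if x = c then [c] else [c, x])"

lemma morph_G_mor: "morph_G = mor 1"
proof
  show "morph_G x = mor 1 x" for x
    by (cases x) (auto simp: morph_G_def mor_def)
qed

lemma morph_D_mor: "morph_D = mor 0"
proof
  show "morph_D x = mor 0 x" for x
    by (cases x) (auto simp: morph_D_def mor_def)
qed

text \<open>The position in the image sequence at which the image of \<open>s k\<close>
  begins.\<close>

definition pos :: "bit \<Rightarrow> (nat \<Rightarrow> bit) \<Rightarrow> nat \<Rightarrow> nat" where
  "pos c s k = (\<Sum>j<k. if s j = c then 1 else 2)"

lemma pos_0 [simp]: "pos c s 0 = 0"
  by (simp add: pos_def)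

lemma pos_Suc [simp]: "pos c s (Suc k) = pos c s k + (if s k = c then 1 else 2)"
  by (simp add: pos_def)

lemma length_concat_mor: "length (concat (map (mor c) (map s [0..<k]))) = pos c s k"
  by (induction k) (auto simp: mor_def)

lemma mor_nonempty: "mor c x \<noteq> []"
  by (simp add: mor_def)

lemma apply_mor_nth:
  assumes "j < length (mor c (s k))"
  shows "apply_morph (mor c) s (pos c s k + j) = mor c (s k) ! j"
proof -
  have "apply_morph (mor c) s (pos c s k + j)
      = concat (map (mor c) (map s [0..<Suc k])) ! (pos c s k + j)"
    by (rule apply_morph_nth[OF mor_nonempty])
       (use assms in \<open>simp only: length_concat_mor, simp add: mor_def split: if_splits\<close>)
  also have "\<dots> = (concat (map (mor c) (map s [0..<k])) @ mor c (s k)) ! (pos c s k + j)"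
    by simp
  also have "\<dots> = mor c (s k) ! j"
    by (subst nth_append) (simp add: length_concat_mor del: map_map)
  finally show ?thesis .
qed

lemma apply_mor_pos: "apply_morph (mor c) s (pos c s k) = c"
  using apply_mor_nth[of 0 c s k] by (auto simp: mor_def split: if_splits)

text \<open>If \<open>s k = c\<close>, its image is \<open>c\<close> alone and the following image
  begins with \<open>c\<close> again. So the letter after an image start always reads off the
  preimage letter, whatever the image length.\<close>

lemma apply_mor_pos_Suc: "apply_morph (mor c) s (Suc (pos c s k)) = s k"
proof (cases "s k = c")
  case True
  then show ?thesis
    using apply_mor_pos[of c s "Suc k"] by simp
next
  case False
  then show ?thesis
    using apply_mor_nth[of 1 c s k] by (simp add: mor_def)
qed

lemma pos_cover: "\<exists>k. i = pos c s k \<or> (i = Suc (pos c s k) \<and> s k \<noteq> c)"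
proof (induction i)
  case 0
  show ?case by (rule exI[of _ 0]) simp
next
  case (Suc i)
  then obtain k where k: "i = pos c s k \<or> (i = Suc (pos c s k) \<and> s k \<noteq> c)" by blast
  then show ?case
  proof
    assume "i = pos c s k"
    then show ?thesis
      by (cases "s k = c") (auto intro: exI[of _ "Suc k"] exI[of _ k])
  next
    assume "i = Suc (pos c s k) \<and> s k \<noteq> c"
    then show ?thesis
      by (auto intro: exI[of _ "Suc k"])
  qed
qed

text \<open>Synchronisation: the second letter of an image of length two is never \<open>c\<close>,
  so the letters \<open>c\<close> mark the cuts between images.\<close>

lemma pos_of_major:
  assumes "apply_morph (mor c) s i = c"
  obtains k where "i = pos c s k"
  using pos_cover[of i c s] assms by (auto simp: apply_mor_pos_Suc)

lemma minor_isolated: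
  assumes "apply_morph (mor c) s i \<noteq> c"
  shows "i > 0" "apply_morph (mor c) s (i - 1) = c" "apply_morph (mor c) s (Suc i) = c"
proof -
  obtain k where k: "i = Suc (pos c s k)" "s k \<noteq> c"
    using pos_cover[of i c s] assms by (auto simp: apply_mor_pos)
  show "i > 0" "apply_morph (mor c) s (i - 1) = c"
    using k by (auto simp: apply_mor_pos)
  show "apply_morph (mor c) s (Suc i) = c"
    using k apply_mor_pos[of c s "Suc k"] by simp
qed

lemma pos_add: "pos c s (k + n) = pos c s k + pos c (\<lambda>j. s (k + j)) n"
  by (induction n) auto

lemma pos_strict_mono: "strict_mono (pos c s)"
  by (simp add: strict_mono_Suc_iff)

lemma pos_cong: "(\<And>j. j < n \<Longrightarrow> s j = s' j) \<Longrightarrow> pos c s n = pos c s' n"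
  by (simp add: pos_def)

text \<open>Decoding from left to right: earlier letters fix where the next image starts, and the
  letter after that start is the next preimage letter.\<close>

lemma apply_mor_inj:
  assumes "apply_morph (mor c) s = apply_morph (mor c) s'"
  shows "s = s'"
proof
  fix n
  show "s n = s' n"
  proof (induction n rule: less_induct)
    case (less n)
    then have "pos c s n = pos c s' n"
      by (intro pos_cong)
    then show ?case
      using apply_mor_pos_Suc[of c s n] apply_mor_pos_Suc[of c s' n] assms by simp
  qed
qed

lemma letter_apply_mor:
  assumes "s k = x"
  shows "\<exists>i. apply_morph (mor c) s i = x"
  using apply_mor_pos_Suc[of c s k] assms by blast

lemma major_square:
  assumes "s k = c"
  shows "\<exists>i. apply_morph (mor c) s i = c \<and> apply_morph (mor c) s (Suc i) = c"
  using apply_mor_pos[of c s k] apply_mor_pos_Suc[of c s k] assms by blast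


subsection \<open>Weights and repetitions\<close>

text \<open>Linear functionals of Parikh vectors; the dual of the incidence matrix of \<open>mor c\<close> is \<open>pull c\<close>.\<close>

definition wt :: "(bit \<Rightarrow> nat) \<Rightarrow> (nat \<Rightarrow> bit) \<Rightarrow> nat \<Rightarrow> nat \<Rightarrow> nat" where
  "wt f s i n = (\<Sum>j<n. f (s (i + j)))"

definition pull :: "bit \<Rightarrow> (bit \<Rightarrow> nat) \<Rightarrow> bit \<Rightarrow> nat" where
  "pull c f x = (if x = c then f c else f c + f x)"

text \<open>The gain \<open>f c\<close> pays for the one further letter \<open>c\<close> by which
  the morphism lengthens a repeated word. This is what makes the vector with 0 and 1 added transform
  linearly.\<close>

lemma pull_sum: "pull c f 0 + pull c f 1 = f 0 + f 1 + f c"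
  by (cases c) (auto simp: pull_def)

lemma wt_0 [simp]: "wt f s i 0 = 0"
  by (simp add: wt_def)

lemma wt_Suc [simp]: "wt f s i (Suc n) = wt f s i n + f (s (i + n))"
  by (simp add: wt_def)

lemma wt_add: "wt f s i (m + n) = wt f s i m + wt f s (i + m) n"
  by (induction n) (auto simp: algebra_simps)

lemma wt_Suc_left: "wt f s i (Suc n) = f (s i) + wt f s (Suc i) n"
  using wt_add[of f s i 1 n] by simp

lemma wt_one [simp]: "wt (\<lambda>_. Suc 0) s i n = n"
  by (induction n) auto

lemma wt_pull:
  "wt f (apply_morph (mor c) s) (pos c s k) (pos c s (k + n) - pos c s k) = wt (pull c f) s k n"
proof (induction n)
  case (Suc n)
  let ?t = "apply_morph (mor c) s"
  define d where "d = pos c s (k + n) - pos c s k"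
  have le: "pos c s (k + n) = pos c s k + d"
    unfolding d_def by (simp add: pos_add)
  have t: "?t (pos c s k + d) = c" "?t (Suc (pos c s k + d)) = s (k + n)"
    using apply_mor_pos[of c s "k + n"] apply_mor_pos_Suc[of c s "k + n"] le by simp_all
  have IH: "wt f ?t (pos c s k) d = wt (pull c f) s k n"
    using Suc d_def by simp
  show ?case
    using IH t by (auto simp: le pull_def[of c f "s (k + n)"] numeral_2_eq_2)
qed simp

text \<open>A word of length \<open>P + m\<close> with period \<open>P\<close> occurs at
  \<open>i\<close>. Counting only the repeated part lets \<open>m = 0\<close> stand for an arbitrary
  period word.\<close>

definition match :: "(nat \<Rightarrow> bit) \<Rightarrow> nat \<Rightarrow> nat \<Rightarrow> nat \<Rightarrow> bool" where
  "match s i P m \<longleftrightarrow> (\<forall>j<m. s (i + j) = s (i + P + j))"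

lemma match_0 [simp]: "match s i P 0"
  by (simp add: match_def)

text \<open>Both copies of the repeated word have the same image, and whatever letters come next,
  both images are followed by \<open>c\<close>. So the repeated part is the image and one more
  letter.\<close>

lemma match_apply_mor:
  fixes c :: bit
  assumes "match s i P m"
  defines "t \<equiv> apply_morph (mor c) s"
  shows "\<exists>i' P' m'. match t i' P' m' \<and> (\<forall>f. wt f t i' P' = wt (pull c f) s i P) \<and>
    (\<forall>f. wt f t i' m' + f 0 + f 1 = wt (pull c f) s i m + pull c f 0 + pull c f 1)"
proof -
  define i' where "i' = pos c s i"
  define P' where "P' = pos c s (i + P) - pos c s i"
  define m0 where "m0 = pos c s (i + m) - pos c s i"
  have iP: "pos c s (i + P) = i' + P'"
    unfolding i'_def P'_def by (simp add: pos_add)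
  have shift: "pos c s (i + P + j) = pos c s (i + j) + P'" if "j \<le> m" for j
  proof -
    have "pos c (\<lambda>l. s (i + P + l)) j = pos c (\<lambda>l. s (i + l)) j"
      using assms(1) that by (intro pos_cong) (auto simp: match_def)
    then show ?thesis
      using iP by (simp add: pos_add i'_def)
  qed
  \<comment> \<open>The bound \<open>i' + m0\<close> is included: there the next image starts, and
    both copies show \<open>c\<close>.\<close>
  have eq: "t x = t (x + P')" if "i' \<le> x" "x \<le> i' + m0" for x
  proof -
    have xm: "x \<le> pos c s (i + m)"
      using that unfolding i'_def m0_def by (simp add: pos_add)
    obtain k where k: "x = pos c s k \<or> (x = Suc (pos c s k) \<and> s k \<noteq> c)"
      using pos_cover by blast
    show ?thesis
    proof (cases "x = pos c s k")
      case True
      then have "i \<le> k" "k \<le> i + m"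
        using that(1) xm strict_mono_less_eq[OF pos_strict_mono, of c s] unfolding i'_def by auto
      then have "t (x + P') = c"
        using shift[of "k - i"] True apply_mor_pos[of c s "P + k"]
        by (simp add: t_def add.commute add.left_commute)
      then show ?thesis
        using True apply_mor_pos by (simp add: t_def)
    next
      case False
      with k have x: "x = Suc (pos c s k)" "s k \<noteq> c" by auto
      have "i \<le> k"
      proof (rule ccontr)
        assume "\<not> i \<le> k"
        then have "Suc k \<le> i" by simp
        then have "pos c s (Suc k) \<le> i'"
          using strict_mono_less_eq[OF pos_strict_mono, of c s] unfolding i'_def by blast
        then show False using x that by simp
      qed
      moreover have "k < i + m"
        using xm x strict_mono_less[OF pos_strict_mono, of c s k "i + m"] by simp
      ultimately have "pos c s (P + k) = pos c s k + P'" "s (P + k) = s k"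
        using shift[of "k - i"] assms(1)[unfolded match_def, rule_format, of "k - i"]
        by (simp_all add: add.commute add.left_commute)
      then show ?thesis
        using x apply_mor_pos_Suc[of c s k] apply_mor_pos_Suc[of c s "P + k"] by (simp add: t_def)
    qed
  qed
  have "match t i' P' (Suc m0)"
    unfolding match_def using eq by (auto simp: less_Suc_eq_le add.commute add.left_commute)
  moreover have "wt f t i' P' = wt (pull c f) s i P" for f
    unfolding t_def i'_def P'_def by (rule wt_pull)
  moreover have "wt f t i' (Suc m0) + f 0 + f 1 = wt (pull c f) s i m + pull c f 0 + pull c f 1" for f
  proof -
    have "wt f t i' m0 = wt (pull c f) s i m"
      unfolding t_def i'_def m0_def by (rule wt_pull)
    moreover have "t (i' + m0) = c"
      using apply_mor_pos[of c s "i + m"] unfolding t_def i'_def m0_def by (simp add: pos_add)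
    ultimately show ?thesis
      using pull_sum[of c f] by simp
  qed
  ultimately show ?thesis by blast
qed

text \<open>Once the repeated word is extended so that it begins and ends with \<open>c\<close>,
  these ends are image starts and can be pulled back. The slack in the last inequality is the weight
  of the letters \<open>c\<close> added by the extension.\<close>

lemma match_desubstitute:
  defines "minor \<equiv> \<lambda>c x :: bit. of_bool (x \<noteq> c) :: nat"
  assumes m: "match (apply_morph (mor c) s) i P m" and "m > 0" and "P > 0"
  shows "\<exists>i' P' m'. match s i' P' m' \<and> P' > 0 \<and> m' + P' < m + P \<and>
    (\<forall>f. wt f (apply_morph (mor c) s) i P = wt (pull c f) s i' P') \<and>
    (\<forall>f. wt f (apply_morph (mor c) s) i m + f 0 + f 1
            \<le> wt (pull c f) s i' m' + pull c f 0 + pull c f 1)"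
proof -
  define t where "t = apply_morph (mor c) s"
  \<comment> \<open>\<open>l\<close> and \<open>r\<close> are 1 if the first or last repeated letter
    is minor. Its outer neighbour is then \<open>c\<close> in both copies, so the match extends by
    that letter.\<close>
  define l where "l = (of_bool (t i \<noteq> c) :: nat)"
  define r where "r = (of_bool (t (i + m - 1) \<noteq> c) :: nat)"
  define i1 where "i1 = i - l"
  define m1 where "m1 = l + m + r"
  have mt: "t (i + j) = t (i + P + j)" if "j < m" for j
    using m that unfolding match_def t_def by blast
  have l: "l \<le> i" and tl: "t i1 = c" "t (i1 + P) = c"
  proof -
    have *: "t (i + P) = t i"
      using mt[of 0] \<open>m > 0\<close> by simp
    show "l \<le> i" "t i1 = c"
      using minor_isolated[of c s i] unfolding l_def t_def i1_def by auto
    show "t (i1 + P) = c"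
    proof (cases "t i = c")
      case True
      then show ?thesis using * by (simp add: i1_def l_def)
    next
      case False
      then have "i > 0" "t (i + P - 1) = c"
        using minor_isolated[of c s "i + P"] minor_isolated[of c s i] * unfolding t_def by auto
      then show ?thesis using False by (simp add: i1_def l_def)
    qed
  qed
  have tr: "t (i1 + (m1 - 1)) = c" "t (i1 + P + (m1 - 1)) = c"
  proof -
    have *: "t (i + m - 1) = t (i + P + m - 1)"
      using mt[of "m - 1"] \<open>m > 0\<close> by simp
    have e: "i1 + (m1 - 1) = i + m - 1 + r" "i1 + P + (m1 - 1) = i + P + m - 1 + r"
      using l \<open>m > 0\<close> unfolding i1_def m1_def by auto
    show "t (i1 + (m1 - 1)) = c" "t (i1 + P + (m1 - 1)) = c"
      unfolding e using minor_isolated(3)[of c s "i + m - 1"] minor_isolated(3)[of c s "i + P + m - 1"] *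
      by (cases "t (i + m - 1) = c"; simp add: r_def t_def)+
  qed
  have m1: "t (i1 + j) = t (i1 + P + j)" if "j < m1" for j
  proof -
    have "l \<le> 1" "r \<le> 1"
      by (simp_all add: l_def r_def)
    with that consider "j = 0" | "j = m1 - 1" | "l \<le> j" "j - l < m"
      unfolding m1_def by linarith
    then show ?thesis
    proof cases
      case 3
      then show ?thesis
        using mt[of "j - l"] l unfolding i1_def by (simp add: add.commute)
    qed (use tl tr in simp_all)
  qed
  \<comment> \<open>Moving the window one place to the left gains a \<open>c\<close> and loses a
    \<open>c\<close>: the period word becomes a conjugate.\<close>
  have wtP: "wt f t i1 P = wt f t i P" for f
  proof (cases "l = 0")
    case False
    then have i: "i = Suc i1" using l unfolding i1_def l_def by (auto split: if_splits)
    show ?thesis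
      using wt_Suc_left[of f t i1 P] tl unfolding i by simp
  qed (simp add: i1_def)
  have wtm: "wt f t i1 m1 = wt f t i m + (l + r) * f c" for f
  proof -
    have A: "wt f t i1 l = l * f c" using tl(1) by (auto simp: l_def)
    have B: "wt f t (i + m) r = r * f c"
    proof (cases "r = 0")
      case False
      then have "r = 1" by (auto simp: r_def)
      moreover have "t (i + m) = c"
        using tr(1) \<open>r = 1\<close> l \<open>m > 0\<close> unfolding i1_def m1_def by simp
      ultimately show ?thesis by simp
    qed simp
    have "wt f t i1 m1 = wt f t i1 l + wt f t i m + wt f t (i + m) r"
      unfolding m1_def wt_add using l by (simp add: i1_def)
    then show ?thesis using A B by (simp add: algebra_simps)
  qed
  obtain i' where i': "i1 = pos c s i'"
    using tl(1) pos_of_major unfolding t_def by blast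
  obtain j' where j': "i1 + P = pos c s j'"
    using tl(2) pos_of_major unfolding t_def by blast
  obtain l' where l': "i1 + (m1 - 1) = pos c s l'"
    using tr(1) pos_of_major unfolding t_def by blast
  have "i' < j'"
    using strict_mono_less[OF pos_strict_mono, of c s i' j'] i' j' \<open>P > 0\<close> by simp
  have "i' \<le> l'"
    using strict_mono_less_eq[OF pos_strict_mono, of c s i' l'] i' l' by simp
  define P' where "P' = j' - i'"
  define m' where "m' = l' - i'"
  have P': "P' > 0" "j' = i' + P'" and m': "l' = i' + m'"
    using \<open>i' < j'\<close> \<open>i' \<le> l'\<close> by (auto simp: P'_def m'_def)
  \<comment> \<open>Positions and letters are proved together: equal letters give equal image
    lengths, and these locate the next pair of letters inside the match of length
    \<open>m1\<close>.\<close>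
  have shift: "pos c s (i' + P' + j) = pos c s (i' + j) + P \<and> (j < m' \<longrightarrow> s (i' + j) = s (i' + P' + j))"
    if "j \<le> m'" for j
    using that
  proof (induction j)
    case 0
    have A: "pos c s (i' + P') = pos c s i' + P"
      using i' j' P' by simp
    have "s i' = s (i' + P')" if "0 < m'"
    proof -
      have "pos c s i' < pos c s l'"
        using that m' strict_mono_less[OF pos_strict_mono, of c s i' l'] by simp
      then have "1 < m1" using i' l' by linarith
      from m1[OF this] show ?thesis
        using apply_mor_pos_Suc[of c s i'] apply_mor_pos_Suc[of c s "i' + P'"] A i'
        by (simp add: t_def)
    qed
    with A show ?case by simp
  next
    case (Suc j)
    then have A: "pos c s (i' + P' + Suc j) = pos c s (i' + Suc j) + P"
      by simp
    have "s (i' + Suc j) = s (i' + P' + Suc j)" if "Suc j < m'"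
    proof -
      define x where "x = pos c s (i' + Suc j) - i1"
      have x: "pos c s (i' + Suc j) = i1 + x"
        unfolding x_def i' using pos_add[of c s i' "Suc j"] by simp
      have "pos c s (i' + Suc j) < pos c s l'"
        using that m' strict_mono_less[OF pos_strict_mono, of c s "i' + Suc j" l'] by simp
      then have "Suc x < m1" using x l' by linarith
      from m1[OF this] show ?thesis
        using apply_mor_pos_Suc[of c s "i' + Suc j"] apply_mor_pos_Suc[of c s "i' + P' + Suc j"] A x
        by (simp add: t_def algebra_simps)
    qed
    with A show ?case by blast
  qed
  have "pos c s (i' + P') - pos c s i' = P"
    using i' j' P' by simp
  then have WP: "wt f t i P = wt (pull c f) s i' P'" for f
    using wt_pull[of f c s i' P'] wtP[of f] i' unfolding t_def by simp
  \<comment> \<open>The final \<open>c\<close> of the extended word begins an image that is not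
    counted in \<open>m'\<close>, hence the single \<open>f c\<close> on the right.\<close>
  have Wm: "wt f t i m + (l + r) * f c = wt (pull c f) s i' m' + f c" for f
  proof -
    have "wt f t i1 m1 = wt f t i1 (m1 - 1) + f (t (i1 + (m1 - 1)))"
      using wt_Suc[of f t i1 "m1 - 1"] \<open>m > 0\<close> unfolding m1_def by simp
    also have "wt f t i1 (m1 - 1) = wt (pull c f) s i' m'"
    proof -
      have "pos c s (i' + m') - pos c s i' = m1 - 1"
        using i' l' m' by simp
      then show ?thesis
        using wt_pull[of f c s i' m'] i' unfolding t_def by simp
    qed
    finally show ?thesis
      using wtm[of f] tr by simp
  qed
  have pull_minor: "pull c (minor c) = minor c"
    by (auto simp: pull_def minor_def)
  have pull_one: "pull c (\<lambda>_. Suc 0) = (\<lambda>x. Suc 0 + minor c x)"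
    by (auto simp: pull_def minor_def)
  have wt_plus: "wt (\<lambda>x. Suc 0 + g x) w k n = n + wt g w k n" for g w k n
    by (induction n) auto
  \<comment> \<open>The morphism preserves the number of minor letters and adds one \<open>c\<close>
    for each of them, so this number is the loss of length.\<close>
  have Pe: "P = P' + wt (minor c) t i P"
    using WP[of "\<lambda>_. Suc 0"] WP[of "minor c"] by (simp only: pull_one pull_minor wt_plus wt_one)
  have me: "m + (l + r) = m' + wt (minor c) t i m + 1"
    using Wm[of "\<lambda>_. Suc 0"] Wm[of "minor c"]
    by (simp only: pull_one pull_minor wt_plus wt_one) (simp add: minor_def)
  have ge: "of_bool (t (i + j) \<noteq> c) \<le> wt (minor c) t i n" if "j < n" for j n
    unfolding wt_def minor_def using that
    by (intro member_le_sum[of j "{..<n}" "\<lambda>j. of_bool (t (i + j) \<noteq> c) :: nat"]) auto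
  \<comment> \<open>Charge \<open>l\<close> to the period word and \<open>r\<close> to the repeated
    word, as for \<open>m = 1\<close> they concern the same letter. The uncounted final
    \<open>c\<close> makes the inequality strict.\<close>
  have "m' + P' < m + P"
  proof -
    have "l \<le> wt (minor c) t i P" "l \<le> wt (minor c) t i m" "r \<le> wt (minor c) t i m"
      using ge[of 0 P] ge[of 0 m] ge[of "m - 1" m] \<open>m > 0\<close> \<open>P > 0\<close> unfolding l_def r_def by simp_all
    then show ?thesis using me Pe by linarith
  qed
  moreover have "match s i' P' m'"
    unfolding match_def using shift by auto
  moreover have "wt f t i m + f 0 + f 1 \<le> wt (pull c f) s i' m' + pull c f 0 + pull c f 1" for f
    using Wm[of f] pull_sum[of c f] by linarith
  ultimately show ?thesis
    using P' WP unfolding t_def by blast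
qed


subsection \<open>Chains of desubstitutions\<close>

text \<open>The \<open>f\<close>-weight of \<open>\<Phi>\<^sub>n(x)\<close>; each step adds a
  morphism on the inside.\<close>

definition push :: "(nat \<Rightarrow> bit) \<Rightarrow> nat \<Rightarrow> (bit \<Rightarrow> nat) \<Rightarrow> bit \<Rightarrow> nat" where
  "push d n f = rec_nat f (\<lambda>k. pull (d k)) n"

lemma push_simps [simp]: "push d 0 f = f" "push d (Suc n) f = pull (d n) (push d n f)"
  by (simp_all add: push_def)

lemma push_pos: "0 < f 0 \<Longrightarrow> 0 < f 1 \<Longrightarrow> 0 < push d n f x"
proof (induction n arbitrary: x)
  case 0
  then show ?case by (cases x) auto
qed (auto simp: pull_def)

locale chain =
  fixes U :: "nat \<Rightarrow> nat \<Rightarrow> bit" and d :: "nat \<Rightarrow> bit"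
  assumes U: "U n = apply_morph (mor (d n)) (U (Suc n))"
begin

lemma match_from_level:
  assumes "match (U n) i P m"
  shows "\<exists>i' P' m'. match (U 0) i' P' m' \<and> (\<forall>f. wt f (U 0) i' P' = wt (push d n f) (U n) i P) \<and>
    (\<forall>f. wt f (U 0) i' m' + f 0 + f 1 = wt (push d n f) (U n) i m + push d n f 0 + push d n f 1)"
  using assms
proof (induction n arbitrary: i P m)
  case 0
  then show ?case by auto
next
  case (Suc n)
  obtain i1 P1 m1 where 1: "match (U n) i1 P1 m1"
      "\<And>f. wt f (U n) i1 P1 = wt (pull (d n) f) (U (Suc n)) i P"
      "\<And>f. wt f (U n) i1 m1 + f 0 + f 1
        = wt (pull (d n) f) (U (Suc n)) i m + pull (d n) f 0 + pull (d n) f 1"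
    using match_apply_mor[OF Suc.prems, of "d n"] unfolding U[of n, symmetric] by blast
  show ?case
    using Suc.IH[OF 1(1)] 1(2,3) by simp
qed

text \<open>Descent on \<open>m + P\<close>, ending when the repeated word is empty. The start level
  \<open>k\<close> is arbitrary for the induction, and \<open>push\<close> refers all weights back
  to level 0.\<close>

lemma match_to_level:
  assumes "match (U k) i P m" "P > 0"
  shows "\<exists>n i' P'. P' > 0 \<and> (\<forall>f. wt (push d k f) (U k) i P = wt (push d n f) (U n) i' P') \<and>
    (\<forall>f. wt (push d k f) (U k) i m + push d k f 0 + push d k f 1 \<le> push d n f 0 + push d n f 1)"
  using assms
proof (induction "m + P" arbitrary: k i P m rule: less_induct)
  case less
  show ?case
  proof (cases "m = 0")
    case True
    then show ?thesis
      using \<open>P > 0\<close> by (intro exI[of _ k] exI[of _ i] exI[of _ P]) simp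
  next
    case False
    obtain i1 P1 m1 where 1: "match (U (Suc k)) i1 P1 m1" "P1 > 0" "m1 + P1 < m + P"
        "\<And>f. wt f (U k) i P = wt (pull (d k) f) (U (Suc k)) i1 P1"
        "\<And>f. wt f (U k) i m + f 0 + f 1
          \<le> wt (pull (d k) f) (U (Suc k)) i1 m1 + pull (d k) f 0 + pull (d k) f 1"
      using match_desubstitute[of "d k" "U (Suc k)" i P m] less.prems False
      unfolding U[of k, symmetric] by blast
    obtain n i' P' where 2: "P' > 0"
        "\<And>f. wt (push d (Suc k) f) (U (Suc k)) i1 P1 = wt (push d n f) (U n) i' P'"
        "\<And>f. wt (push d (Suc k) f) (U (Suc k)) i1 m1 + push d (Suc k) f 0 + push d (Suc k) f 1
          \<le> push d n f 0 + push d n f 1"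
      using less.hyps[OF 1(3,1,2)] by blast
    show ?thesis
    proof (intro exI conjI allI)
      show "wt (push d k f) (U k) i P = wt (push d n f) (U n) i' P'" for f
        using 1(4)[of "push d k f"] 2(2)[of f] by simp
      show "wt (push d k f) (U k) i m + push d k f 0 + push d k f 1 \<le> push d n f 0 + push d n f 1" for f
        using 1(5)[of "push d k f"] 2(3)[of f] by simp
    qed fact
  qed
qed

text \<open>\<open>U k\<close> begins with \<open>d k\<close>, and every letter of a sequence
  survives in its image.\<close>

lemma letter_occurs:
  assumes "n \<le> k" "d k = x"
  shows "\<exists>i. U n i = x"
  using assms
proof (induction rule: inc_induct)
  case base
  then show ?case
    using apply_mor_pos[of "d k" "U (Suc k)" 0] U[of k] by auto
next
  case (step n)
  then show ?case
    using letter_apply_mor[of "U (Suc n)" _ x "d n"] U[of n] by auto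
qed

text \<open>The later level \<open>k\<close> puts the letter \<open>d n\<close> into
  \<open>U (Suc n)\<close>. Its image there is a single letter, and the next image begins with the
  same letter.\<close>

lemma major_square_occurs:
  assumes "n < k" "d k = d n"
  shows "\<exists>i. U n i = d n \<and> U n (Suc i) = d n"
  using major_square[of "U (Suc n)" _ "d n"] letter_occurs[of "Suc n" k "d n"] assms U[of n]
  by auto

lemma minor_isolated_level:
  assumes "U n i \<noteq> d n"
  shows "U n (Suc i) = d n"
  using minor_isolated(3)[of "d n" "U (Suc n)" i] assms U[of n] by simp

end

section \<open>Parity of ones, and the critical exponent as a supremum over levels\<close>

definition ones :: "bit \<Rightarrow> nat" where
  "ones x = of_bool (x = 1)"

text \<open>\<open>L\<close> stands for \<open>|\<Phi>\<^sub>n(w)|\<close>; the two values of \<open>push\<close> are \<open>|\<Phi>\<^sub>n(0)|\<close> and \<open>|\<Phi>\<^sub>n(1)|\<close>.\<close>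

definition level_exponent :: "(nat \<Rightarrow> bit) \<Rightarrow> nat \<Rightarrow> nat \<Rightarrow> real" where
  "level_exponent d n L =
    1 + (real (push d n (\<lambda>_. 1) 0 + push d n (\<lambda>_. 1) 1) - 1) / real L"

lemma sum_S: "(\<Sum>j<n. \<S> v (i + j)) = v i + v (i + n)"
  by (induction n) (auto simp: \<S>_def algebra_simps)

lemma sum_bit_ones: "(\<Sum>j<n. s (i + j)) = of_nat (wt ones s i n)"
proof (induction n)
  case (Suc n)
  have "s (i + n) = of_nat (ones (s (i + n)))"
    by (cases "s (i + n)") (auto simp: ones_def)
  with Suc show ?case by simp
qed simp

text \<open>The sum modulo 2 telescopes to the two end letters. This parity decides whether a period
  of \<open>\<S> v\<close> lifts to a period of \<open>v\<close>.\<close>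

lemma wt_S_even: "even (wt ones (\<S> v) i n) \<longleftrightarrow> v i = v (i + n)"
proof -
  have "of_nat k = (0 :: bit) \<longleftrightarrow> even k" for k
    by (induction k) auto
  then have "even (wt ones (\<S> v) i n) \<longleftrightarrow> v i + v (i + n) = 0"
    by (metis sum_S sum_bit_ones)
  also have "\<dots> \<longleftrightarrow> v i = v (i + n)"
    by (cases "v i"; cases "v (i + n)") auto
  finally show ?thesis .
qed

lemma lang_transfer:
  assumes "lang s = lang s'"
  obtains i' where "\<And>j. j < n \<Longrightarrow> s (i + j) = s' (i' + j)"
proof -
  have "map s [i..<i + n] \<in> lang s'"
    using assms unfolding lang_def by blast
  then obtain i' n' where *: "map s [i..<i + n] = map s' [i'..<i' + n']"
    unfolding lang_def by auto
  then have "n = n'"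
    by (metis add_diff_cancel_left' length_map length_upt)
  then have "s (i + j) = s' (i' + j)" if "j < n" for j
    using arg_cong[OF *, of "\<lambda>w. w ! j"] that by simp
  then show ?thesis using that by blast
qed

lemma wt_cong: "(\<And>j. j < n \<Longrightarrow> s (i + j) = s' (i' + j)) \<Longrightarrow> wt f s i n = wt f s' i' n"
  by (simp add: wt_def)

lemma match_cong:
  assumes "\<And>j. j < P + m \<Longrightarrow> s (i + j) = s' (i' + j)"
  shows "match s i P m = match s' i' P m"
proof -
  have "s (i + j) = s' (i' + j) \<and> s (i + P + j) = s' (i' + P + j)" if "j < m" for j
    using assms[of j] assms[of "P + j"] that by (simp add: add.assoc)
  then show ?thesis by (simp add: match_def)
qed

lemma match_period:
  assumes "match s i P m" "P > 0" "j < P + m"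
  shows "s (i + j) = s (i + j mod P)"
  using assms(3)
proof (induction j rule: less_induct)
  case (less j)
  show ?case
  proof (cases "j < P")
    case False
    then have "s (i + (j - P)) = s (i + j)"
      using assms(1) less.prems unfolding match_def by (auto dest: spec[of _ "j - P"])
    moreover have "s (i + (j - P)) = s (i + (j - P) mod P)"
      using less.prems False \<open>P > 0\<close> by (intro less.IH) auto
    ultimately show ?thesis
      using False by (simp add: le_mod_geq)
  qed simp
qed

lemma cr_ge_match:
  assumes "match v i P m" "P > 0"
  shows "ereal (1 + real m / real P) \<le> cr v"
proof -
  define z where "z = map v [i..<i + (P + m)]"
  define w where "w = map v [i..<i + P]"
  have "is_power z w (of_nat (P + m) / of_nat P)"
    unfolding is_power_def
  proof (intro conjI)
    show "w \<noteq> []" using \<open>P > 0\<close> by (simp add: w_def)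
    show "of_nat (P + m) / of_nat P = (of_nat (length z) / of_nat (length w) :: rat)"
      by (simp add: z_def w_def)
    show "z = map (omega_power w) [0..<length z]"
    proof (rule nth_equalityI)
      fix j assume "j < length z"
      then have j: "j < P + m" by (simp add: z_def)
      have "j mod P < P" using \<open>P > 0\<close> by simp
      then have "w ! (j mod P) = v (i + j mod P)" by (simp add: w_def)
      then show "z ! j = map (omega_power w) [0..<length z] ! j"
        using j match_period[OF assms j] by (simp add: z_def omega_power_def) (simp add: w_def)
    qed simp
  qed
  moreover have "z \<in> lang v" "w \<in> lang v" "w \<noteq> []"
    using \<open>P > 0\<close> unfolding z_def w_def lang_def by auto
  ultimately have "ereal (real_of_rat (of_nat (P + m) / of_nat P)) \<le> ind v w" "ind v w \<le> cr v"
    unfolding ind_def cr_def by (auto intro!: Sup_upper)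
  moreover have "real_of_rat (of_nat (P + m) / of_nat P) = 1 + real m / real P"
    using \<open>P > 0\<close> by (simp only: of_rat_divide of_rat_of_nat_eq) (simp add: field_simps)
  ultimately show ?thesis by simp
qed

text \<open>Exponents up to 1 are covered by \<open>1 \<le> B\<close>; any larger one leaves a
  non-empty repeated part, whence \<open>Suc m\<close>.\<close>

lemma cr_le_matches:
  assumes "1 \<le> B" and "\<And>i P m. match v i P (Suc m) \<Longrightarrow> P > 0 \<Longrightarrow> ereal (1 + real (Suc m) / real P) \<le> B"
  shows "cr v \<le> B"
proof -
  have "ereal (real_of_rat e) \<le> B" if "z \<in> lang v" "is_power z w e" for z w e
  proof -
    define P where "P = length w"
    obtain i L where z: "z = map v [i..<i + L]"
      using \<open>z \<in> lang v\<close> unfolding lang_def by blast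
    have P: "P > 0" and e: "real_of_rat e = real L / real P"
      using that(2) unfolding is_power_def P_def z by (auto simp: of_rat_divide)
    have vj: "v (i + j) = w ! (j mod P)" if "j < L" for j
    proof -
      have "z ! j = map (omega_power w) [0..<length z] ! j"
        using \<open>is_power z w e\<close> unfolding is_power_def by simp
      then show ?thesis
        using that by (simp add: z omega_power_def P_def)
    qed
    show ?thesis
    proof (cases "L \<le> P")
      case True
      then have "real_of_rat e \<le> 1" using P by (simp add: e)
      then show ?thesis
        using \<open>1 \<le> B\<close> by (metis ereal_less_eq(3) one_ereal_def order_trans)
    next
      case False
      then obtain m where L: "L = P + Suc m"
        by (metis add_Suc_right less_imp_Suc_add not_le)
      have "match v i P (Suc m)"
        unfolding match_def
      proof (intro allI impI)
        fix j assume "j < Suc m"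
        then show "v (i + j) = v (i + P + j)"
          using vj[of j] vj[of "P + j"] L by (simp add: add.assoc)
      qed
      moreover have "real_of_rat e = 1 + real (Suc m) / real P"
        using P by (simp add: e L field_simps)
      ultimately show ?thesis using assms(2) P by metis
    qed
  qed
  then show ?thesis
    unfolding cr_def ind_def by (auto intro!: Sup_least)
qed

context chain
begin

text \<open>A factor of \<open>U n\<close> with empty repeated word is mapped to level 0, where the
  repeated part has length \<open>|\<Phi>\<^sub>n(01)| - 2\<close>; lifting to \<open>v\<close> adds
  one letter.\<close>

lemma cr_ge_level:
  assumes "lang (\<S> v) = lang (U 0)" "P > 0" "even (wt (push d n ones) (U n) i P)"
  shows "ereal (level_exponent d n (wt (push d n (\<lambda>_. 1)) (U n) i P)) \<le> cr v"
proof -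
  obtain i' P' m' where 1: "match (U 0) i' P' m'"
      "\<And>f. wt f (U 0) i' P' = wt (push d n f) (U n) i P"
      "\<And>f. wt f (U 0) i' m' + f 0 + f 1 = push d n f 0 + push d n f 1"
    using match_from_level[of n i P 0] by auto
  have P': "P' = wt (push d n (\<lambda>_. 1)) (U n) i P"
    using 1(2)[of "\<lambda>_. 1"] by simp
  have "P' > 0"
  proof -
    obtain P0 where "P = Suc P0" using \<open>P > 0\<close> by (cases P) auto
    then show ?thesis unfolding P' by (simp add: push_pos)
  qed
  obtain i2 where i2: "\<And>j. j < P' + m' \<Longrightarrow> U 0 (i' + j) = \<S> v (i2 + j)"
    using lang_transfer[OF assms(1)[symmetric]] by metis
  have "match (\<S> v) i2 P' m'"
    using 1(1) match_cong[of P' m' "U 0" i' "\<S> v" i2] i2 by simp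
  have "wt ones (\<S> v) i2 P' = wt ones (U 0) i' P'"
    using i2 by (intro wt_cong) simp
  then have "v i2 = v (i2 + P')"
    using assms(3) 1(2)[of ones] wt_S_even[of v i2 P'] by simp
  \<comment> \<open>Parity gives equality at the start, and each of the \<open>m'\<close> matching
    differences carries it one place further, so \<open>Suc m'\<close> letters agree.\<close>
  have "v (i2 + j) = v (i2 + P' + j)" if "j < Suc m'" for j
    using that
  proof (induction j)
    case (Suc j)
    have cancel: "x = y" if "z + x = z + y" for x y z :: bit
      using that by (rule add_left_imp_eq)
    from Suc have "v (i2 + j) = v (i2 + P' + j)" "\<S> v (i2 + j) = \<S> v (i2 + P' + j)"
      using \<open>match (\<S> v) i2 P' m'\<close> by (auto simp: match_def)
    then show ?case
      using cancel[of "v (i2 + j)"] unfolding \<S>_def by (metis Suc_eq_plus1 add_Suc_right)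
  qed (use \<open>v i2 = v (i2 + P')\<close> in simp)
  then have "match v i2 P' (Suc m')"
    by (simp add: match_def)
  from cr_ge_match[OF this \<open>P' > 0\<close>]
  have "ereal (1 + real (Suc m') / real P') \<le> cr v" .
  moreover have "real (Suc m') = real (push d n (\<lambda>_. 1) 0 + push d n (\<lambda>_. 1) 1) - 1"
    using 1(3)[of "\<lambda>_. 1"] by simp
  ultimately show ?thesis
    unfolding level_exponent_def P' by metis
qed

text \<open>Passing to \<open>\<S> v\<close> shortens the repeated part by one letter. The descent
  then reaches a level with the same period length and parity, whose exponent is at least as
  large.\<close>

lemma cr_le_levels:
  assumes "lang (\<S> v) = lang (U 0)" "1 \<le> B"
    and "\<And>n i P. P > 0 \<Longrightarrow> even (wt (push d n ones) (U n) i P) \<Longrightarrow>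
      ereal (level_exponent d n (wt (push d n (\<lambda>_. 1)) (U n) i P)) \<le> B"
  shows "cr v \<le> B"
proof (rule cr_le_matches[OF assms(2)])
  fix i P m assume m: "match v i P (Suc m)" and "P > 0"
  have mS: "match (\<S> v) i P m"
    unfolding match_def
  proof (intro allI impI)
    fix j assume "j < m"
    then have "v (i + j) = v (i + P + j)" "v (i + Suc j) = v (i + P + Suc j)"
      using m unfolding match_def by (metis less_Suc_eq Suc_less_eq)+
    then show "\<S> v (i + j) = \<S> v (i + P + j)" by (simp add: \<S>_def)
  qed
  have ev: "even (wt ones (\<S> v) i P)"
    using m wt_S_even[of v i P] by (auto simp: match_def)
  obtain i2 where i2: "\<And>j. j < P + m \<Longrightarrow> \<S> v (i + j) = U 0 (i2 + j)"
    using lang_transfer[OF assms(1)] by metis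
  have "match (U 0) i2 P m"
    using mS match_cong[of P m "\<S> v" i "U 0" i2] i2 by simp
  then obtain n i' P' where 1: "P' > 0"
      "\<And>f. wt f (U 0) i2 P = wt (push d n f) (U n) i' P'"
      "\<And>f. wt f (U 0) i2 m + f 0 + f 1 \<le> push d n f 0 + push d n f 1"
    using match_to_level[of 0 i2 P m] \<open>P > 0\<close> by auto
  have "wt ones (\<S> v) i P = wt ones (U 0) i2 P"
    using i2 by (intro wt_cong) simp
  then have ev': "even (wt (push d n ones) (U n) i' P')"
    using ev 1(2)[of ones] by simp
  have P: "P = wt (push d n (\<lambda>_. 1)) (U n) i' P'"
    using 1(2)[of "\<lambda>_. 1"] by simp
  have "real (Suc m) \<le> real (push d n (\<lambda>_. 1) 0 + push d n (\<lambda>_. 1) 1) - 1"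
    using 1(3)[of "\<lambda>_. 1"] by simp
  then have "1 + real (Suc m) / real P \<le> level_exponent d n P"
    unfolding level_exponent_def by (simp add: divide_right_mono)
  also have "ereal (level_exponent d n P) \<le> B"
    using assms(3)[OF 1(1) ev'] unfolding P .
  finally show "ereal (1 + real (Suc m) / real P) \<le> B" by simp
qed

end


subsection \<open>Evaluation over the blocks of the directive sequence\<close>

lemma conv_rec_ge_1: "1 \<le> conv_rec 1 1 a k"
  by (induction "1::nat" "1::nat" a k rule: conv_rec.induct) auto

text \<open>Run backwards, the recurrence would carry two consecutive even terms down to the initial
  values.\<close>

lemma conv_rec_not_both_even:
  assumes "odd x \<or> odd y"
  shows "odd (conv_rec x y a k) \<or> odd (conv_rec x y a (Suc k))"
  using assms by (induction k) auto

locale block_chain = chain +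
  fixes a :: "nat \<Rightarrow> nat" and c :: bit
  assumes a_pos: "i \<ge> 1 \<Longrightarrow> a i > 0"
    and d_block: "(\<Sum>i=1..k. a i) \<le> n \<Longrightarrow> n < (\<Sum>i=1..k + 1. a i) \<Longrightarrow>
      d n = (if even k then c else other c)"
begin

abbreviation start :: "nat \<Rightarrow> nat" where
  "start k \<equiv> (\<Sum>i=1..k. a i)"

definition major :: "nat \<Rightarrow> bit" where
  "major k = (if even k then c else other c)"

text \<open>
  For \<open>f = 1\<close> this is the sequence \<open>q'\<close>; for \<open>f = ones\<close> it is \<open>q\<close> if \<open>c = 1\<close> and \<open>p\<close> if \<open>c = 0\<close>.
  As in \<open>conv_rec\<close>, the argument is the index plus one.
\<close>

definition conv :: "(bit \<Rightarrow> nat) \<Rightarrow> nat \<Rightarrow> nat" where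
  "conv f k = conv_rec (f (other c)) (f c) a k"

abbreviation (input) "Q \<equiv> conv (\<lambda>_. 1)"

lemma d_eq_major: "j < a (Suc k) \<Longrightarrow> d (start k + j) = major k"
  using d_block[of k "start k + j"] by (simp add: major_def)

lemma major_Suc: "major (Suc k) = other (major k)"
  by (simp add: major_def)

lemma block_exists: "\<exists>k j. n = start k + j \<and> j < a (Suc k)"
proof (induction n)
  case 0
  show ?case using a_pos[of 1] by (intro exI[of _ 0]) simp
next
  case (Suc n)
  then obtain k j where k: "n = start k + j" "j < a (Suc k)" by blast
  show ?case
  proof (cases "Suc j < a (Suc k)")
    case True
    with k show ?thesis by (intro exI[of _ k] exI[of _ "Suc j"]) simp
  next
    case False
    with k a_pos[of "Suc (Suc k)"] show ?thesis
      by (intro exI[of _ "Suc k"] exI[of _ 0]) simp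
  qed
qed

text \<open>Each step inside a block keeps the weight of the major letter and adds it to that of the
  other. At \<open>j = a (Suc k)\<close> this completes the recurrence of \<open>conv\<close>, and
  the letters exchange roles for the next block.\<close>

lemma push_block:
  assumes "j \<le> a (Suc k)"
  shows "push d (start k + j) f (major k) = conv f (Suc k) \<and>
    push d (start k + j) f (other (major k)) = j * conv f (Suc k) + conv f k"
  using assms
proof (induction k arbitrary: j)
  case 0
  then show ?case
  proof (induction j)
    case 0
    then show ?case by (simp add: conv_def major_def)
  next
    case (Suc j)
    then show ?case
      using d_eq_major[of j 0] by (simp add: pull_def)
  qed
next
  case (Suc k)
  from Suc.prems show ?case
  proof (induction j)
    case 0
    have "push d (start (Suc k) + 0) f = push d (start k + a (Suc k)) f"
      by simp
    then show ?case
      using Suc.IH[of "a (Suc k)"] by (simp add: major_Suc conv_def del: sum.cl_ivl_Suc)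
  next
    case (Suc j)
    then show ?case
      using d_eq_major[of j "Suc k"] by (simp add: pull_def del: sum.cl_ivl_Suc)
  qed
qed

lemma Q_ge_1: "1 \<le> Q k"
  unfolding conv_def by (rule conv_rec_ge_1)

lemma ones_not_both_even: "odd (conv ones k) \<or> odd (conv ones (Suc k))"
  unfolding conv_def by (rule conv_rec_not_both_even) (cases c; simp add: ones_def)

lemma Q_Suc_Suc: "Q (Suc (Suc k)) = a (Suc k) * Q (Suc k) + Q k"
  by (simp add: conv_def)

lemma total_length:
  assumes "j \<le> a (Suc k)"
  shows "push d (start k + j) (\<lambda>_. 1) 0 + push d (start k + j) (\<lambda>_. 1) 1
    = (j + 1) * Q (Suc k) + Q k"
  using push_block[OF assms, of "\<lambda>_. 1"] by (cases "major k") auto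

lemma level_exponent_block:
  assumes "j \<le> a (Suc k)"
  shows "level_exponent d (start k + j) L
    = 1 + ((real j + 1) * real (Q (Suc k)) + real (Q k) - 1) / real L"
  unfolding level_exponent_def total_length[OF assms] by (simp only: of_nat_add of_nat_mult of_nat_1)

text \<open>The union of the three sets, for both forms of the directive sequence at once. Through
  the index shift, \<open>Q N\<close> is \<open>q'\<close> at \<open>N - 1\<close> and
  \<open>Q (Suc N)\<close> is \<open>q'\<close> at \<open>N\<close>.\<close>

definition M :: "real set" where
  "M = {real (a (N + 1)) + 2 + (real (Q N) - 1) / real (Q (Suc N)) | N. even (conv ones (Suc N))} \<union>
    {(real (a (N + 1)) + 2) / 2 + (real (Q N) - 1) / (2 * real (Q (Suc N))) | N. odd (conv ones (Suc N))} \<union>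
    {2 + (real (Q (Suc N)) - 1) / (real (Q N) + real (Q (Suc N)))
      | N. N \<ge> 1 \<and> odd (conv ones N) \<and> odd (conv ones (Suc N)) \<and> a (N + 1) > 1}"

lemma M1_I:
  "even (conv ones (Suc N)) \<Longrightarrow> real (a (N + 1)) + 2 + (real (Q N) - 1) / real (Q (Suc N)) \<in> M"
  unfolding M_def by blast

lemma M2_I:
  "odd (conv ones (Suc N)) \<Longrightarrow>
    (real (a (N + 1)) + 2) / 2 + (real (Q N) - 1) / (2 * real (Q (Suc N))) \<in> M"
  unfolding M_def by blast

lemma M3_I:
  "N \<ge> 1 \<Longrightarrow> odd (conv ones N) \<Longrightarrow> odd (conv ones (Suc N)) \<Longrightarrow> a (N + 1) > 1 \<Longrightarrow>
    2 + (real (Q (Suc N)) - 1) / (real (Q N) + real (Q (Suc N))) \<in> M"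
  unfolding M_def by blast

text \<open>Elements of the first kind are always large enough. If there are none, some
  \<open>a (Suc N)\<close> exceeds 1, since otherwise two odd terms would add up to an even one;
  that \<open>N\<close> gives a suitable element of the second kind.\<close>

lemma M_ge_2: "\<exists>e\<in>M. 2 \<le> e"
proof (cases "\<exists>N. even (conv ones (Suc N))")
  case True
  then obtain N where "even (conv ones (Suc N))" by blast
  moreover have "2 \<le> real (a (N + 1)) + 2 + (real (Q N) - 1) / real (Q (Suc N))"
    using Q_ge_1[of N] by simp
  ultimately show ?thesis
    using M1_I[of N] by blast
next
  case False
  have "\<exists>N. a (Suc N) \<ge> 2"
  proof (rule ccontr)
    assume "\<not> ?thesis"
    then have "\<not> 2 \<le> a (Suc N)" for N
      by blast
    then have a1: "a (Suc N) = 1" for N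
      using a_pos[of "Suc N"] \<open>\<And>N. \<not> 2 \<le> a (Suc N)\<close>[of N] by linarith
    have "conv ones (Suc (Suc (Suc 0))) = conv ones (Suc (Suc 0)) + conv ones (Suc 0)"
      using a1[of 1] by (simp add: conv_def)
    then show False using False by (metis odd_add)
  qed
  then obtain N where "a (Suc N) \<ge> 2" by blast
  then have "2 \<le> (real (a (N + 1)) + 2) / 2 + (real (Q N) - 1) / (2 * real (Q (Suc N)))"
    using Q_ge_1[of N] by (intro order_trans[OF _ add_increasing2[OF _ order_refl]]) auto
  then show ?thesis using M2_I[of N] False by blast
qed

lemma level_exponent_le_M:
  assumes "P > 0" "even (wt (push d n ones) (U n) i P)"
  shows "\<exists>e\<in>M. level_exponent d n (wt (push d n (\<lambda>_. 1)) (U n) i P) \<le> e"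
proof -
  obtain k j where n: "n = start k + j" and j: "j < a (Suc k)"
    using block_exists by blast
  have dn: "d n = major k"
    using d_eq_major[OF j] n by simp
  define cnt where "cnt x = wt (\<lambda>y. of_bool (y = x)) (U n) i P" for x
  define xc where "xc = cnt (major k)"
  define xe where "xe = cnt (other (major k))"
  have wt_cnt: "wt f (U n) i P = xe * f (other (major k)) + xc * f (major k)" for f
  proof -
    have "wt f s i P = wt (\<lambda>y. of_bool (y = other x)) s i P * f (other x)
        + wt (\<lambda>y. of_bool (y = x)) s i P * f x" for s x
    proof (induction P)
      case (Suc P)
      have "f y = of_bool (y = other x) * f (other x) + of_bool (y = x) * f x" for y
        by (cases x; cases y) auto
      from this[of "s (i + P)"] Suc show ?case
        by (simp add: algebra_simps)
    qed simp
    then show ?thesis unfolding xc_def xe_def cnt_def .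
  qed
  define q where "q = real (Q (Suc k))"
  define r where "r = real (Q k)"
  have q: "1 \<le> q" and r: "1 \<le> r"
    unfolding q_def r_def using Q_ge_1 by (metis of_nat_1 of_nat_le_iff)+
  define L where "L = wt (push d n (\<lambda>_. 1)) (U n) i P"
  have L: "real L = real xe * (real j * q + r) + real xc * q"
    unfolding L_def wt_cnt using push_block[of j k "\<lambda>_. 1"] j by (simp add: q_def r_def n)
  have V: "level_exponent d n L = 1 + ((real j + 1) * q + r - 1) / real L"
    using level_exponent_block[of j k L] j by (simp add: n q_def r_def)
  have num: "0 \<le> (real j + 1) * q + r - 1"
  proof -
    have "0 \<le> real j * q" "(real j + 1) * q = real j * q + q"
      using q by (simp_all add: distrib_right)
    then show ?thesis using q r by linarith
  qed
  have ev: "even (xe * (j * conv ones (Suc k) + conv ones k) + xc * conv ones (Suc k))"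
    using assms(2) push_block[of j k ones] j unfolding wt_cnt by (simp add: n)
  have total: "xe + xc = P"
    using wt_cnt[of "\<lambda>_. Suc 0"] by simp
  have aj: "real j + 1 \<le> real (a (k + 1))"
    using j by simp
  consider "xe = 0" | "xe = 1" "xc = 0" | "xe \<ge> 2" "xc = 0" | "xe \<ge> 1" "xc \<ge> 1"
    by fastforce
  then have "\<exists>e\<in>M. level_exponent d n L \<le> e"
  proof cases
    case 1
    show ?thesis
    proof (cases "even (conv ones (Suc k))")
      case True
      have "q \<le> real L"
        using 1 total \<open>P > 0\<close> q by (simp add: L)
      then have "level_exponent d n L \<le> 1 + ((real j + 1) * q + r - 1) / q"
        unfolding V using num q by (intro add_left_mono divide_left_mono mult_pos_pos) auto
      also have "\<dots> = real j + 1 + 1 + (r - 1) / q"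
        using q by (simp add: field_simps)
      also have "\<dots> \<le> real (a (k + 1)) + 2 + (r - 1) / q"
        using aj by simp
      finally show ?thesis
        using M1_I[OF True] unfolding q_def r_def by blast
    next
      case False
      then have "even xc" using ev 1 by simp
      then have "2 \<le> xc" using 1 total \<open>P > 0\<close> by (cases "xc = 1") auto
      then have "2 * q \<le> real L"
        using 1 q by (simp add: L)
      then have "level_exponent d n L \<le> 1 + ((real j + 1) * q + r - 1) / (2 * q)"
        unfolding V using num q by (intro add_left_mono divide_left_mono mult_pos_pos) auto
      also have "\<dots> = (real j + 1 + 2) / 2 + (r - 1) / (2 * q)"
        using q by (simp add: field_simps)
      also have "\<dots> \<le> (real (a (k + 1)) + 2) / 2 + (r - 1) / (2 * q)"
        using aj by simp
      finally show ?thesis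
        using M2_I[OF False] unfolding q_def r_def by blast
    qed
  next
    case 2
    have jr: "0 < real j * q + r"
      using q r by (intro add_nonneg_pos) auto
    have V2: "level_exponent d n L = 2 + (q - 1) / (real j * q + r)"
      unfolding V using 2 jr by (simp add: L) (simp add: field_simps)
    have evj: "even (j * conv ones (Suc k) + conv ones k)"
      using ev 2 by simp
    then have odd: "odd (conv ones (Suc k))"
      using ones_not_both_even[of k] by auto
    show ?thesis
    proof (cases k)
      case 0
      \<comment> \<open>In the first block there is no earlier block to refer to, but the exponent
        is exactly 2.\<close>
      then have "q = 1" by (simp add: q_def conv_def)
      then show ?thesis using M_ge_2 V2 by simp
    next
      case (Suc k')
      show ?thesis
      proof (cases "even (conv ones k)")
        case True
        \<comment> \<open>The extreme case \<open>j = 0\<close> is also the end of block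
          \<open>k'\<close>, where this letter was the major one; the recurrence turns the bound
          into the element of the first kind for \<open>k'\<close>.\<close>
        have "level_exponent d n L \<le> 2 + (q - 1) / r"
          unfolding V2 using q r jr by (intro add_left_mono divide_left_mono mult_pos_pos) auto
        also have "\<dots> = real (a (k' + 1)) + 2 + (real (Q k') - 1) / real (Q (Suc k'))"
          using r Q_Suc_Suc[of k'] unfolding q_def r_def Suc by (simp add: field_simps)
        finally show ?thesis
          using M1_I[of k'] True unfolding Suc by blast
      next
        case False
        \<comment> \<open>Two odd weights exclude \<open>j = 0\<close>, so \<open>j = 1\<close> is
          the extreme case.\<close>
        then have "odd j" using evj odd by simp
        then have "j \<ge> 1" by (cases j) auto
        then have "1 * q \<le> real j * q"
          using q by (intro mult_right_mono) auto
        then have "level_exponent d n L \<le> 2 + (q - 1) / (r + q)"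
          unfolding V2 using q r jr by (intro add_left_mono divide_left_mono mult_pos_pos) auto
        moreover have "a (k + 1) > 1" using j \<open>j \<ge> 1\<close> by simp
        ultimately show ?thesis
          using M3_I[of k] False odd Suc unfolding q_def r_def by auto
      qed
    qed
  next
    case 3
    then have "2 \<le> P" using total by simp
    have "U n (i + l) \<noteq> d n" if "l < P" for l
    proof
      assume "U n (i + l) = d n"
      then have "of_bool (U n (i + l) = major k) = (1::nat)" by (simp add: dn)
      moreover have "of_bool (U n (i + l) = major k) \<le> xc"
        unfolding xc_def cnt_def wt_def using that
        by (intro member_le_sum[of l "{..<P}" "\<lambda>l. of_bool (U n (i + l) = major k) :: nat"]) auto
      ultimately show False using 3 by simp
    qed
    from this[of 0] this[of 1] show ?thesis
      using minor_isolated_level[of n i] \<open>2 \<le> P\<close> by simp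
  next
    case 4
    \<comment> \<open>With both letters present, \<open>L\<close> is at least
      \<open>|\<Phi>\<^sub>n(01)|\<close>, so the fraction is at most 1.\<close>
    have "1 * (real j * q + r) + 1 * q \<le> real L"
      unfolding L using 4 q r by (intro add_mono mult_right_mono) auto
    then have "(real j + 1) * q + r - 1 \<le> real L"
      by (simp add: algebra_simps)
    then have "((real j + 1) * q + r - 1) / real L \<le> 1"
      by (cases "L = 0") (auto simp: divide_le_eq_1)
    then have "level_exponent d n L \<le> 2"
      unfolding V by simp
    then show ?thesis using M_ge_2 order_trans by blast
  qed
  then show ?thesis unfolding L_def .
qed

text \<open>Blocks are non-empty, so blocks \<open>n\<close> and \<open>Suc n\<close> both start at
  level \<open>n\<close> or later, and their major letters differ.\<close>

lemma major_later: "\<exists>l\<ge>n. d l = x"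
proof -
  have ge: "k \<le> start k" for k
  proof (induction k)
    case (Suc k)
    then show ?case using a_pos[of "Suc k"] by simp
  qed simp
  have d: "d (start k) = major k" for k
    using d_eq_major[of 0 k] a_pos[of "Suc k"] by simp
  have "x = major n \<or> x = major (Suc n)"
    by (cases x; cases "major n") (auto simp: major_Suc)
  moreover have "n \<le> start n" "n \<le> start (Suc n)"
    using ge[of n] ge[of "Suc n"] by linarith+
  ultimately show ?thesis using d by metis
qed

lemma letter_occurs': "\<exists>i. U n i = x"
  using major_later letter_occurs by blast

lemma cr_ge_M:
  assumes "lang (\<S> v) = lang (U 0)" "e \<in> M"
  shows "ereal e \<le> cr v"
proof -
  consider (1) N where "even (conv ones (Suc N))"
      "e = real (a (N + 1)) + 2 + (real (Q N) - 1) / real (Q (Suc N))"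
    | (2) N where "odd (conv ones (Suc N))"
      "e = (real (a (N + 1)) + 2) / 2 + (real (Q N) - 1) / (2 * real (Q (Suc N)))"
    | (3) N where "odd (conv ones N)" "odd (conv ones (Suc N))" "a (N + 1) > 1"
      "e = 2 + (real (Q (Suc N)) - 1) / (real (Q N) + real (Q (Suc N)))"
    using assms(2) unfolding M_def by blast
  then show ?thesis
  proof cases
    case 1
    \<comment> \<open>At the end of the block the other letter has become as long as possible, while
      \<open>major N\<close> still has length \<open>Q (Suc N)\<close>.\<close>
    define n where "n = start N + a (Suc N)"
    have push: "push d n f (major N) = conv f (Suc N)" for f
      using push_block[of "a (Suc N)" N] by (simp add: n_def)
    obtain i where "U n i = major N"
      using letter_occurs' by blast
    then have wt: "wt (push d n f) (U n) i 1 = conv f (Suc N)" for f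
      by (simp add: push)
    have "e = level_exponent d n (Q (Suc N))"
      unfolding 1(2) n_def level_exponent_block[OF order_refl] using Q_ge_1[of "Suc N"]
      by (simp add: field_simps)
    then show ?thesis
      using cr_ge_level[OF assms(1), of 1 n i] 1(1) by (simp only: wt)
  next
    case 2
    \<comment> \<open>The square of \<open>major N\<close> is obtained from
      \<open>d n = major N\<close>, so the last level inside the block is taken, one before its
      end.\<close>
    define j where "j = a (Suc N) - 1"
    define n where "n = start N + j"
    have j: "Suc j = a (Suc N)"
      using a_pos[of "Suc N"] by (simp add: j_def)
    have push: "push d n f (major N) = conv f (Suc N)" for f
      using push_block[of j N] j by (simp add: n_def)
    have dn: "d n = major N"
      using d_eq_major[of j N] j by (simp add: n_def)
    obtain l where "l > n" "d l = d n"
      using major_later[of "Suc n" "d n"] Suc_le_lessD by blast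
    then obtain i where "U n i = major N" "U n (Suc i) = major N"
      using major_square_occurs[of n l] dn by auto
    then have wt: "wt (push d n f) (U n) i 2 = 2 * conv f (Suc N)" for f
      by (simp add: push numeral_2_eq_2)
    have "e = level_exponent d n (2 * Q (Suc N))"
      unfolding 2(2) n_def using level_exponent_block[of j N "2 * Q (Suc N)"] Q_ge_1[of "Suc N"] j[symmetric]
      by (simp add: field_simps)
    then show ?thesis
      using cr_ge_level[OF assms(1), of 2 n i] by (simp only: wt) simp
  next
    case 3
    \<comment> \<open>One step into the block the number of ones for the other letter is the sum of
      two odd terms, hence even.\<close>
    define n where "n = start N + 1"
    have push: "push d n f (other (major N)) = conv f (Suc N) + conv f N" for f
      using push_block[of 1 N] 3(3) by (simp add: n_def)
    obtain i where "U n i = other (major N)"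
      using letter_occurs' by blast
    then have wt: "wt (push d n f) (U n) i 1 = conv f (Suc N) + conv f N" for f
      by (simp add: push)
    have "0 < real (Q (Suc N)) + real (Q N)"
      using Q_ge_1[of "Suc N"] by linarith
    then have "e = level_exponent d n (Q (Suc N) + Q N)"
      unfolding 3(4) n_def using level_exponent_block[of 1 N "Q (Suc N) + Q N"] 3(3)
      by (simp add: field_simps)
    then show ?thesis
      using cr_ge_level[OF assms(1), of 1 n i] 3(1,2) by (simp only: wt) simp
  qed
qed

lemma cr_eq_Sup:
  assumes "lang (\<S> v) = lang (U 0)"
  shows "cr v = Sup (ereal ` M)"
proof (rule antisym)
  show "cr v \<le> Sup (ereal ` M)"
  proof (rule cr_le_levels[OF assms])
    obtain e where "e \<in> M" "2 \<le> e" using M_ge_2 by blast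
    then have "1 \<le> ereal e" "ereal e \<le> Sup (ereal ` M)"
      by (auto intro: Sup_upper)
    then show "1 \<le> Sup (ereal ` M)" by (rule order_trans)
  next
    fix n i P assume "P > 0" "even (wt (push d n ones) (U n) i P)"
    then obtain e where "e \<in> M" "level_exponent d n (wt (push d n (\<lambda>_. 1)) (U n) i P) \<le> e"
      using level_exponent_le_M by blast
    then show "ereal (level_exponent d n (wt (push d n (\<lambda>_. 1)) (U n) i P)) \<le> Sup (ereal ` M)"
      by (intro order_trans[OF _ Sup_upper[of "ereal e"]]) auto
  qed
  show "Sup (ereal ` M) \<le> cr v"
    using cr_ge_M[OF assms] by (auto intro: Sup_least)
qed

end

section \<open>From the directive sequence to a block chain, and the two cases of the
  theorem\<close>

lemma directive_seq_chain:
  assumes "directive_seq u \<Delta>"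
  obtains U d where "\<And>n. \<Delta> n = mor (d n)" "chain U d" "U 0 = u"
proof -
  obtain U where U: "\<And>n. u = foldr (\<lambda>i. apply_morph (\<Delta> i)) [0..<n] (U n)"
    using assms unfolding directive_seq_def by blast
  have "\<Delta> n \<in> {mor 1, mor 0}" for n
    using assms unfolding directive_seq_def morph_G_mor morph_D_mor by blast
  then have "\<exists>c. \<Delta> n = mor c" for n
    by blast
  then obtain d where d: "\<And>n. \<Delta> n = mor (d n)" by metis
  \<comment> \<open>\<open>U n\<close> and \<open>U (Suc n)\<close> are each related only to
    \<open>u\<close>; cancelling the common outer morphisms relates them to each other.\<close>
  have inj: "s = s'" if "foldr (\<lambda>i. apply_morph (\<Delta> i)) xs s = foldr (\<lambda>i. apply_morph (\<Delta> i)) xs s'"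
    for xs s s'
    using that
  proof (induction xs)
    case (Cons x xs)
    then show ?case
      using apply_mor_inj[of "d x"] unfolding foldr.simps comp_apply d by blast
  qed simp
  have "chain U d"
  proof
    fix n
    show "U n = apply_morph (mor (d n)) (U (Suc n))"
    proof (rule inj)
      show "foldr (\<lambda>i. apply_morph (\<Delta> i)) [0..<n] (U n)
          = foldr (\<lambda>i. apply_morph (\<Delta> i)) [0..<n] (apply_morph (mor (d n)) (U (Suc n)))"
        using U[of n] U[of "Suc n"] by (simp add: d)
    qed
  qed
  moreover have "U 0 = u" using U[of 0] by simp
  ultimately show ?thesis using that d by blast
qed

lemma mor_inj:
  assumes "mor x = mor y"
  shows "x = y"
proof -
  have "length (mor x x) = length (mor y x)"
    using assms by simp
  then show ?thesis by (simp add: mor_def split: if_splits)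
qed

lemma block_chain_of_alternating:
  assumes "chain U d" "\<And>n. \<Delta> n = mor (d n)" "alternating_blocks (mor c) (mor (other c)) a \<Delta>"
  shows "block_chain U d a c"
proof -
  interpret chain U d by fact
  show ?thesis
  proof
    show "0 < a i" if "1 \<le> i" for i
      using assms(3) that by (simp add: alternating_blocks_def)
    show "d n = (if even k then c else other c)"
      if "(\<Sum>i=1..k. a i) \<le> n" "n < (\<Sum>i=1..k + 1. a i)" for k n
    proof -
      have "mor (d n) = (if even k then mor c else mor (other c))"
        using assms(3)[unfolded alternating_blocks_def assms(2), THEN conjunct2, rule_format, of k n]
          that by metis
      then have "mor (d n) = mor (if even k then c else other c)"
        by (simp only: if_distrib[of mor])
      then show ?thesis by (rule mor_inj)
    qed
  qed
qed

theorem theorem33: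
  fixes v u :: "nat \<Rightarrow> bit" and \<Delta> :: "nat \<Rightarrow> bit \<Rightarrow> bit list" and a :: "nat \<Rightarrow> nat"
  assumes "cs_rote v"
    and "standard_sturmian u"
    and "lang (\<S> v) = lang u"
    and "directive_seq u \<Delta>"
  shows "(alternating_blocks morph_G morph_D a \<Delta> \<longrightarrow>
      cr v = Sup (ereal ` (
        {real (a (N + 1)) + 2 + (real (conv_q' a (int N - 1)) - 1) / real (conv_q' a (int N))
           | N :: nat. even (conv_q a (int N))} \<union>
        {(real (a (N + 1)) + 2) / 2 + (real (conv_q' a (int N - 1)) - 1) / (2 * real (conv_q' a (int N)))
           | N :: nat. odd (conv_q a (int N))} \<union>
        {2 + (real (conv_q' a (int N)) - 1) / (real (conv_q' a (int N - 1)) + real (conv_q' a (int N)))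
           | N :: nat. N \<ge> 1 \<and> odd (conv_q a (int N - 1)) \<and> odd (conv_q a (int N)) \<and> a (N + 1) > 1}))) \<and>
    (alternating_blocks morph_D morph_G a \<Delta> \<longrightarrow>
      cr v = Sup (ereal ` (
        {real (a (N + 1)) + 2 + (real (conv_q' a (int N - 1)) - 1) / real (conv_q' a (int N))
           | N :: nat. even (conv_p a (int N))} \<union>
        {(real (a (N + 1)) + 2) / 2 + (real (conv_q' a (int N - 1)) - 1) / (2 * real (conv_q' a (int N)))
           | N :: nat. odd (conv_p a (int N))} \<union>
        {2 + (real (conv_q' a (int N)) - 1) / (real (conv_q' a (int N - 1)) + real (conv_q' a (int N)))
           | N :: nat. N \<ge> 1 \<and> odd (conv_p a (int N - 1)) \<and> odd (conv_p a (int N)) \<and> a (N + 1) > 1})))"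
proof -
  obtain U d where d: "\<And>n. \<Delta> n = mor (d n)" and chain: "chain U d" and "U 0 = u"
    using directive_seq_chain[OF assms(4)] by blast
  have lang: "lang (\<S> v) = lang (U 0)"
    using assms(3) \<open>U 0 = u\<close> by simp
  have nat: "nat (int N + 1) = Suc N" "nat (int N - 1 + 1) = N" for N
    by simp_all
  note conv_nat = conv_q'_def conv_q_def conv_p_def nat
  show ?thesis
  proof (intro conjI impI)
    assume "alternating_blocks morph_G morph_D a \<Delta>"
    then have "alternating_blocks (mor 1) (mor (other 1)) a \<Delta>"
      by (simp only: morph_G_mor morph_D_mor other_simps)
    \<comment> \<open>The parameter \<open>c\<close> belongs to the first block: 1 for
      \<open>G\<close>, which makes \<open>conv ones\<close> the sequence \<open>q\<close>, and 0
      for \<open>D\<close> below, which makes it \<open>p\<close>.\<close>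
    then interpret block_chain U d a 1
      by (rule block_chain_of_alternating[OF chain d])
    show "cr v = Sup (ereal ` (
        {real (a (N + 1)) + 2 + (real (conv_q' a (int N - 1)) - 1) / real (conv_q' a (int N))
           | N :: nat. even (conv_q a (int N))} \<union>
        {(real (a (N + 1)) + 2) / 2 + (real (conv_q' a (int N - 1)) - 1) / (2 * real (conv_q' a (int N)))
           | N :: nat. odd (conv_q a (int N))} \<union>
        {2 + (real (conv_q' a (int N)) - 1) / (real (conv_q' a (int N - 1)) + real (conv_q' a (int N)))
           | N :: nat. N \<ge> 1 \<and> odd (conv_q a (int N - 1)) \<and> odd (conv_q a (int N)) \<and> a (N + 1) > 1}))"
      using cr_eq_Sup[OF lang]
      by (simp only: M_def conv_def conv_nat ones_def other_simps zero_neq_one of_bool_eq simp_thms)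
  next
    assume "alternating_blocks morph_D morph_G a \<Delta>"
    then have "alternating_blocks (mor 0) (mor (other 0)) a \<Delta>"
      by (simp only: morph_G_mor morph_D_mor other_simps)
    then interpret block_chain U d a 0
      by (rule block_chain_of_alternating[OF chain d])
    show "cr v = Sup (ereal ` (
        {real (a (N + 1)) + 2 + (real (conv_q' a (int N - 1)) - 1) / real (conv_q' a (int N))
           | N :: nat. even (conv_p a (int N))} \<union>
        {(real (a (N + 1)) + 2) / 2 + (real (conv_q' a (int N - 1)) - 1) / (2 * real (conv_q' a (int N)))
           | N :: nat. odd (conv_p a (int N))} \<union>
        {2 + (real (conv_q' a (int N)) - 1) / (real (conv_q' a (int N - 1)) + real (conv_q' a (int N)))
           | N :: nat. N \<ge> 1 \<and> odd (conv_p a (int N - 1)) \<and> odd (conv_p a (int N)) \<and> a (N + 1) > 1}))"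
      using cr_eq_Sup[OF lang]
      by (simp only: M_def conv_def conv_nat ones_def other_simps zero_neq_one of_bool_eq simp_thms)
  qed
qed

end
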